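(* Let $x^*$ be an optimal solution of $\min_{x\in\mathbb{R}^n}F(x)$, and let $0<\mu\le 1/\max_{1\le i\le K}L(f_i)$. Then the sequence $\{x_{(k)}^i,w_{(k)}^i\}_{i=1}^K$, $k=0,1,2,\ldots$, generated by Algorithm MSA (with starting point $x_0\in\mathbb{R}^n$, parameter $\mu$, and any doubly stochastic matrices $D^{(k)}$) satisfies, for all $k\ge 1$, $$\min_{i=1,\ldots,K}F(x_{(k)}^i)-F(x^* )\le\frac{(K-1)\|x_0-x^*\|^2}{2\mu k}.$$ Thus the sequence $\{\min_{i=1,\ldots,K}F(x_{(k)}^i)\}_k$ converges to $F(x^* )$. Moreover, if $\mu\ge\beta/\max_i\{L(f_i)\}$ where $0<\beta\le 1$, then for every $\epsilon>0$ the number of iterations needed to obtain an $\epsilon$-optimal solution (i.e. the smallest $k$ with $\min_{i=1,\ldots,K}F(x_{(k)}^i)-F(x^* )\le\epsilon$) is at most $\lceil C/\epsilon\rceil$, where $$C=\frac{(K-1)\max_i\{L(f_i)\}\,\|x_0-x^*\|^2}{2\beta}.$$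
   Context: Setting: $K\ge 2$ and $n\geq 1$ are integers, $\|\cdot\|$ is the Euclidean norm on $\mathbb{R}^n$. For $i=1,\ldots,K$, $f_i:\mathbb{R}^n\to\mathbb{R}$ is convex and continuously differentiable with Lipschitz continuous gradient: $\|\nabla f_i(x)-\nabla f_i(y)\|\le L(f_i)\|x-y\|$ for all $x,y\in\mathbb{R}^n$, where $L(f_i)$ is the Lipschitz constant ($\max_i L(f_i)>0$, so that $1/\max_i L(f_i)$ is defined). Put $F(x)=\sum_{i=1}^K f_i(x)$; it is assumed that $F$ attains its minimum on $\mathbb{R}^n$. A point $x$ is an $\epsilon$-optimal solution if $F(x)-F(x^* )\le\epsilon$, where $x^*$ is a minimizer of $F$. Notation: for $\mu>0$ let $\tilde f_j(u,v):=f_j(v)+\langle\nabla f_j(v),u-v\rangle+\frac{1}{2\mu}\|u-v\|^2$, and $$Q_i(v^1,\ldots,v^{i-1},u,v^{i+1},\ldots,v^K):=f_i(u)+\sum_{j=1,j\ne i}^K\tilde f_j(u,v^j),$$ $$p_i(v^1,\ldots,v^{i-1},v^{i+1},\ldots,v^K):=\arg\min_{u\in\mathbb{R}^n}Q_i(v^1,\ldots,v^{i-1},u,v^{i+1},\ldots,v^K).$$ In $p_i(w,\ldots,w)$ all $K-1$ arguments equal $w$. A real $K\times K$ matrix $D$ is doubly stochastic if its entries are nonnegative and all its row sums and column sums equal $1$. Algorithm MSA: let $D^{(1)},D^{(2)},\ldots$ be doubly stochastic $K\times K$ matrices. Set $x_0=x_{(0)}^1=\cdots=x_{(0)}^K=w_{(0)}^1=\cdots=w_{(0)}^K$.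 For $k=0,1,2,\ldots$: for each $i=1,\ldots,K$ compute $x_{(k+1)}^i:=p_i(w_{(k)}^i,\ldots,w_{(k)}^i)$; then compute $(w_{(k+1)}^1,\ldots,w_{(k+1)}^K):=(x_{(k+1)}^1,\ldots,x_{(k+1)}^K)D^{(k+1)}$, i.e. $w_{(k+1)}^i=\sum_{j=1}^K D^{(k+1)}_{ji}x_{(k+1)}^j$. *)

theory Defs
  imports "HOL-Analysis.Analysis"
begin

definition gradient :: "('a::real_inner \<Rightarrow> real) \<Rightarrow> 'a \<Rightarrow> 'a" where
  "gradient f x = (THE g. GDERIV f x :> g)"

definition continuously_differentiable :: "('a::real_inner \<Rightarrow> real) \<Rightarrow> bool" where
  "continuously_differentiable f \<longleftrightarrow>
     (\<forall>x. f differentiable (at x)) \<and> continuous_on UNIV (gradient f)"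

text \<open>Families with index set \<open>{1..K}\<close> are functions on \<^typ>\<open>nat\<close>; their values at other
  indices are irrelevant.\<close>

definition objective :: "nat \<Rightarrow> (nat \<Rightarrow> 'a \<Rightarrow> real) \<Rightarrow> 'a \<Rightarrow> real" where
  "objective K f x = (\<Sum>i=1..K. f i x)"

definition prox_linear :: "real \<Rightarrow> ('a::real_inner \<Rightarrow> real) \<Rightarrow> 'a \<Rightarrow> 'a \<Rightarrow> real" where
  "prox_linear \<mu> g u v = g v + gradient g v \<bullet> (u - v) + 1 / (2 * \<mu>) * (norm (u - v))\<^sup>2"

text \<open>\<open>msa_Q K f \<mu> i v u\<close> is $Q_i(v^1,\ldots,v^{i-1},u,v^{i+1},\ldots,v^K)$; the entry \<open>v i\<close> is not used.\<close>

definition msa_Q :: "nat \<Rightarrow> (nat \<Rightarrow> 'a::real_inner \<Rightarrow> real) \<Rightarrow> real \<Rightarrow> nat \<Rightarrow> (nat \<Rightarrow> 'a) \<Rightarrow> 'a \<Rightarrow> real" where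
  "msa_Q K f \<mu> i v u = f i u + (\<Sum>j\<in>{1..K} - {i}. prox_linear \<mu> (f j) u (v j))"

text \<open>For convex differentiable \<open>f i\<close> on a Euclidean space, \<open>\<mu> > 0\<close> and \<open>K \<ge> 2\<close> the function
  \<open>msa_Q K f \<mu> i v\<close> is strongly convex and continuous, so the choice made by \<^const>\<open>arg_min\<close> is
  its unique minimizer.\<close>

definition msa_p :: "nat \<Rightarrow> (nat \<Rightarrow> 'a::real_inner \<Rightarrow> real) \<Rightarrow> real \<Rightarrow> nat \<Rightarrow> (nat \<Rightarrow> 'a) \<Rightarrow> 'a" where
  "msa_p K f \<mu> i v = arg_min (msa_Q K f \<mu> i v) (\<lambda>u. True)"

definition doubly_stochastic :: "nat \<Rightarrow> (nat \<Rightarrow> nat \<Rightarrow> real) \<Rightarrow> bool" where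
  "doubly_stochastic K D \<longleftrightarrow>
     (\<forall>i\<in>{1..K}. \<forall>j\<in>{1..K}. 0 \<le> D i j) \<and>
     (\<forall>i\<in>{1..K}. (\<Sum>j=1..K. D i j) = 1) \<and>
     (\<forall>j\<in>{1..K}. (\<Sum>i=1..K. D i j) = 1)"

text \<open>\<open>msa_x K f \<mu> D x0 k i\<close> and \<open>msa_w K f \<mu> D x0 k i\<close> are $x_{(k)}^i$ and $w_{(k)}^i$;
  \<open>D k\<close> is the matrix $D^{(k)}$, and \<open>D 0\<close> is not used.\<close>

function msa_x msa_w ::
  "nat \<Rightarrow> (nat \<Rightarrow> 'a::real_inner \<Rightarrow> real) \<Rightarrow> real \<Rightarrow> (nat \<Rightarrow> nat \<Rightarrow> nat \<Rightarrow> real) \<Rightarrow> 'a \<Rightarrow>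
   nat \<Rightarrow> nat \<Rightarrow> 'a" where
  "msa_x K f \<mu> D x0 0 i = x0"
| "msa_x K f \<mu> D x0 (Suc k) i = msa_p K f \<mu> i (\<lambda>j. msa_w K f \<mu> D x0 k i)"
| "msa_w K f \<mu> D x0 0 i = x0"
| "msa_w K f \<mu> D x0 (Suc k) i = (\<Sum>j=1..K. D (Suc k) j i *\<^sub>R msa_x K f \<mu> D x0 (Suc k) j)"
  by pat_completeness auto
termination
  by (relation "Wellfounded.measure (case_sum (\<lambda>(K, f, \<mu>, D, x0, k, i). 2 * k)
                                              (\<lambda>(K, f, \<mu>, D, x0, k, i). 2 * k + 1))") auto

definition msa_best ::
  "nat \<Rightarrow> (nat \<Rightarrow> 'a::real_inner \<Rightarrow> real) \<Rightarrow> real \<Rightarrow> (nat \<Rightarrow> nat \<Rightarrow> nat \<Rightarrow> real) \<Rightarrow> 'a \<Rightarrow> nat \<Rightarrow> real"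
  where
  "msa_best K f \<mu> D x0 k = Min ((\<lambda>i. objective K f (msa_x K f \<mu> D x0 k i)) ` {1..K})"

end

theory Submission
  imports Defs
begin

text \<open>The surrogate $Q_i(\cdot\,;w)$ lies above $F$ by the descent lemma, lies below
  $F + \frac{K-1}{2\mu}\|\cdot-w\|^2$ by convexity, and is strongly convex with modulus $(K-1)/\mu$.
  Comparing its minimizer $p$ with an arbitrary $u$ gives
  $F(p)-F(u)\le\frac{K-1}{2\mu}(\|u-w\|^2-\|u-p\|^2)$.
  By Jensen's inequality, mixing with a doubly stochastic matrix does not increase the sum of a convex
  function over the $K$ points. With $u=w$ this makes $\sum_i F(x^i_{(k)})$ nonincreasing in $k$;
  with $u=x^*$ the sum over $i$ telescopes in $k$. Finally the minimum is at most the average.\<close>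

section \<open>Gradients, tangent planes and quadratic upper bounds\<close>

lemma GDERIV_gradient:
  fixes f :: "'a::euclidean_space \<Rightarrow> real"
  assumes "f differentiable (at x)"
  shows "GDERIV f x :> gradient f x"
proof -
  obtain A where A: "(f has_derivative A) (at x)"
    using assms by (auto simp: differentiable_def)
  \<comment> \<open>The Riesz representative of the functional \<open>A\<close> is its adjoint
    applied to the real number 1.\<close>
  have "h \<bullet> adjoint A 1 = A h" for h
    using adjoint_works[OF has_derivative_linear[OF A], of h 1] by simp
  with A have D: "GDERIV f x :> adjoint A 1"
    by (simp add: gderiv_def)
  have "g = adjoint A 1" if "GDERIV f x :> g" for g
  proof -
    have "(\<lambda>h. h \<bullet> g) = (\<lambda>h. h \<bullet> adjoint A 1)"
      using has_derivative_unique that D unfolding gderiv_def by blast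
    then show ?thesis
      by (metis vector_eq_ldot)
  qed
  with D show ?thesis
    unfolding gradient_def by (rule theI)
qed

text \<open>Reduces the next two inequalities to calculus in one real variable.\<close>

lemma DERIV_along_line:
  fixes f :: "'a::euclidean_space \<Rightarrow> real"
  assumes "\<And>x. f differentiable (at x)"
  shows "((\<lambda>t. f (x + t *\<^sub>R d)) has_real_derivative gradient f (x + t *\<^sub>R d) \<bullet> d) (at t)"
proof -
  have "(f has_derivative (\<lambda>h. h \<bullet> gradient f (x + t *\<^sub>R d))) (at (x + t *\<^sub>R d))"
    using GDERIV_gradient[OF assms] by (simp add: gderiv_def)
  moreover have "((\<lambda>t. x + t *\<^sub>R d) has_derivative (\<lambda>s. s *\<^sub>R d)) (at t)"
    by (auto intro!: derivative_eq_intros)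
  ultimately have "((\<lambda>t. f (x + t *\<^sub>R d)) has_derivative
      (\<lambda>s. (s *\<^sub>R d) \<bullet> gradient f (x + t *\<^sub>R d))) (at t)"
    by (rule has_derivative_compose[rotated])
  moreover have "(\<lambda>s. (s *\<^sub>R d) \<bullet> g) = (*) (g \<bullet> d)" for g
    by (simp add: fun_eq_iff inner_commute[of d])
  ultimately show ?thesis
    by (simp add: has_field_derivative_def)
qed

text \<open>On the line from \<open>x\<close> through \<open>y\<close> the function is convex in one
  variable, so its value at 1 lies above the tangent taken at 0.\<close>

lemma convex_on_gradient_ineq:
  fixes f :: "'a::euclidean_space \<Rightarrow> real"
  assumes "convex_on UNIV f" "\<And>x. f differentiable (at x)"
  shows "f x + gradient f x \<bullet> (y - x) \<le> f y"
proof -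
  define \<phi> where "\<phi> t = f (x + t *\<^sub>R (y - x))" for t
  have "convex_on UNIV \<phi>"
  proof (rule convex_onI)
    fix t a b :: real
    assume "0 < t" "t < 1"
    moreover have "x + ((1 - t) *\<^sub>R a + t *\<^sub>R b) *\<^sub>R (y - x) =
        (1 - t) *\<^sub>R (x + a *\<^sub>R (y - x)) + t *\<^sub>R (x + b *\<^sub>R (y - x))"
      by (simp add: algebra_simps)
    ultimately show "\<phi> ((1 - t) *\<^sub>R a + t *\<^sub>R b) \<le> (1 - t) * \<phi> a + t * \<phi> b"
      using convex_onD[OF assms(1), of t] by (simp add: \<phi>_def)
  qed simp
  moreover have "(\<phi> has_real_derivative gradient f x \<bullet> (y - x)) (at 0)"
    using DERIV_along_line[OF assms(2), of x "y - x" 0] by (simp add: \<phi>_def[abs_def])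
  ultimately have "\<phi> 1 - \<phi> 0 \<ge> (gradient f x \<bullet> (y - x)) * (1 - 0)"
    by (intro convex_on_imp_above_tangent[where A = UNIV]) auto
  then show ?thesis
    by (simp add: \<phi>_def)
qed

text \<open>Subtract the claimed linear and quadratic terms from \<open>f\<close> along the segment.
  By Cauchy-Schwarz and the Lipschitz bound the difference \<open>\<phi>\<close> has nonpositive
  derivative on [0,1]; the claim compares its endpoints.\<close>

lemma descent_lemma:
  fixes f :: "'a::euclidean_space \<Rightarrow> real"
  assumes "\<And>x. f differentiable (at x)" and lip: "L-lipschitz_on UNIV (gradient f)"
  shows "f y \<le> f x + gradient f x \<bullet> (y - x) + L / 2 * (norm (y - x))\<^sup>2"
proof -
  define d where "d = y - x"
  define \<phi> where
    "\<phi> t = f (x + t *\<^sub>R d) - t * (gradient f x \<bullet> d) - L / 2 * t\<^sup>2 * (norm d)\<^sup>2" for t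
  have "\<phi> 1 \<le> \<phi> 0"
  proof (rule DERIV_nonpos_imp_nonincreasing[where f = \<phi>])
    fix t :: real
    assume t: "0 \<le> t" "t \<le> 1"
    have "(gradient f (x + t *\<^sub>R d) - gradient f x) \<bullet> d
        \<le> norm (gradient f (x + t *\<^sub>R d) - gradient f x) * norm d"
      by (rule norm_cauchy_schwarz)
    also have "\<dots> \<le> (L * (t * norm d)) * norm d"
      using lipschitz_onD[OF lip, of "x + t *\<^sub>R d" x] t
      by (intro mult_right_mono) (simp_all add: dist_norm)
    finally have "gradient f (x + t *\<^sub>R d) \<bullet> d - gradient f x \<bullet> d - L * t * (norm d)\<^sup>2 \<le> 0"
      by (simp add: inner_diff_left power2_eq_square algebra_simps)
    moreover have "(\<phi> has_real_derivative
        gradient f (x + t *\<^sub>R d) \<bullet> d - gradient f x \<bullet> d - L * t * (norm d)\<^sup>2) (at t)"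
      unfolding \<phi>_def
      by (rule derivative_eq_intros DERIV_along_line assms refl | simp)+
    ultimately show "\<exists>D. (\<phi> has_real_derivative D) (at t) \<and> D \<le> 0"
      by blast
  qed simp
  then show ?thesis
    by (simp add: \<phi>_def d_def)
qed

section \<open>Convexity, strong convexity, existence of minimizers and averaging\<close>

lemma norm_convex_combination_squared:
  fixes x y w :: "'a::real_inner"
  shows "(norm ((1 - t) *\<^sub>R x + t *\<^sub>R y - w))\<^sup>2 =
    (1 - t) * (norm (x - w))\<^sup>2 + t * (norm (y - w))\<^sup>2 - t * (1 - t) * (norm (y - x))\<^sup>2"
  unfolding power2_norm_eq_inner
  by (simp add: inner_diff_left inner_diff_right inner_add_left inner_add_right
      inner_commute[of y x] inner_commute[of w x] inner_commute[of w y] algebra_simps)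

lemma convex_on_norm_diff_squared:
  "convex_on UNIV (\<lambda>x::'a::real_inner. (norm (x - w))\<^sup>2)"
  by (rule convex_onI) (simp_all add: norm_convex_combination_squared)

lemma convex_on_affine_inner:
  "convex_on UNIV (\<lambda>x::'a::real_inner. c + g \<bullet> (x - w))"
  by (rule convex_onI) (simp_all add: inner_diff_right inner_add_right algebra_simps)

lemma convex_on_sum_functions:
  assumes "\<And>i. i \<in> I \<Longrightarrow> convex_on UNIV (f i)"
  shows "convex_on UNIV (\<lambda>x. \<Sum>i\<in>I. f i x)"
  using assms
  by (induction I rule: infinite_finite_induct) (simp_all add: convex_on_const convex_on_add)

text \<open>Compare \<open>p\<close> with the point a fraction \<open>t\<close> of the way to
  \<open>u\<close>. The exact convexity defect of the squared norm leaves a gain of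
  \<open>t * (1 - t) * a\<close> times the squared distance from \<open>p\<close> to
  \<open>u\<close>. Dividing by \<open>t\<close> and letting \<open>t\<close> tend to 0 from the
  right gives the full term.\<close>

lemma strongly_convex_minimizer:
  fixes h :: "'a::real_inner \<Rightarrow> real"
  assumes "convex_on UNIV h"
    and min: "\<And>u. h p + a * (norm (p - w))\<^sup>2 \<le> h u + a * (norm (u - w))\<^sup>2"
  shows "h p + a * (norm (p - w))\<^sup>2 + a * (norm (u - p))\<^sup>2 \<le> h u + a * (norm (u - w))\<^sup>2"
proof -
  define P where "P = h p + a * (norm (p - w))\<^sup>2"
  define U where "U = h u + a * (norm (u - w))\<^sup>2"
  have "P + (1 - t) * (a * (norm (u - p))\<^sup>2) \<le> U" if t: "0 < t" "t < 1" for t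
  proof -
    let ?q = "(1 - t) *\<^sub>R p + t *\<^sub>R u"
    have "P \<le> h ?q + a * (norm (?q - w))\<^sup>2"
      unfolding P_def by (rule min)
    also have "\<dots> \<le> ((1 - t) * h p + t * h u) + a * (norm (?q - w))\<^sup>2"
      using convex_onD[OF assms(1), of t p u] t by simp
    also have "\<dots> = (1 - t) * P + t * U - t * ((1 - t) * (a * (norm (u - p))\<^sup>2))"
      unfolding P_def U_def norm_convex_combination_squared by (simp add: algebra_simps)
    finally have "t * (P + (1 - t) * (a * (norm (u - p))\<^sup>2)) \<le> t * U"
      by (simp add: algebra_simps)
    with t show ?thesis
      by simp
  qed
  then have "\<forall>\<^sub>F t in at_right 0. P + (1 - t) * (a * (norm (u - p))\<^sup>2) \<le> U"
    by (auto simp: eventually_at_right_field intro!: exI[of _ 1])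
  moreover have "((\<lambda>t. P + (1 - t) * (a * (norm (u - p))\<^sup>2)) \<longlongrightarrow>
      P + (1 - 0) * (a * (norm (u - p))\<^sup>2)) (at_right 0)"
    by (intro tendsto_intros)
  ultimately show ?thesis
    unfolding P_def U_def using tendsto_upperbound by fastforce
qed

text \<open>Outside the ball of radius \<open>norm g / a\<close> around \<open>w\<close> the
  quadratic term outweighs the linear one, so \<open>h\<close> is at least \<open>h w\<close> there.
  Hence a minimum over this compact ball is global.\<close>

lemma quadratic_growth_attains_min:
  fixes h :: "'a::euclidean_space \<Rightarrow> real"
  assumes "continuous_on UNIV h" and "0 < a"
    and growth: "\<And>u. h w + g \<bullet> (u - w) + a * (norm (u - w))\<^sup>2 \<le> h u"
  obtains p where "\<And>u. h p \<le> h u"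
proof -
  define r where "r = norm g / a"
  have "0 \<le> r"
    using assms by (simp add: r_def)
  obtain p where p: "p \<in> cball w r" "\<And>u. u \<in> cball w r \<Longrightarrow> h p \<le> h u"
    using continuous_attains_inf[of "cball w r" h] \<open>0 \<le> r\<close>
      continuous_on_subset[OF assms(1)] by (metis compact_cball cball_eq_empty not_less subset_UNIV)
  have "h p \<le> h u" for u
  proof (cases "u \<in> cball w r")
    case False
    then have "r \<le> norm (u - w)"
      by (simp add: dist_norm norm_minus_commute)
    then have "norm g * norm (u - w) \<le> a * norm (u - w) * norm (u - w)"
      using \<open>0 < a\<close> by (intro mult_right_mono) (simp_all add: r_def field_simps)
    moreover have "- (norm g * norm (u - w)) \<le> g \<bullet> (u - w)"
      using Cauchy_Schwarz_ineq2[of g "u - w"] by linarith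
    ultimately have "h w \<le> h u"
      using growth[of u] by (simp add: power2_eq_square algebra_simps)
    then show ?thesis
      using p(2)[of w] \<open>0 \<le> r\<close> by simp
  qed (use p in simp)
  then show thesis
    by (rule that)
qed

text \<open>Column sums 1 make every mixed point a convex combination, so Jensen applies; after
  exchanging the sums, row sums 1 give each \<open>\<phi> (x j)\<close> total weight 1.\<close>

lemma doubly_stochastic_convex_sum_le:
  fixes x :: "nat \<Rightarrow> 'a::real_vector"
  assumes "doubly_stochastic K D" and "convex_on UNIV \<phi>" and "K > 0"
  shows "(\<Sum>i=1..K. \<phi> (\<Sum>j=1..K. D j i *\<^sub>R x j)) \<le> (\<Sum>j=1..K. \<phi> (x j))"
proof -
  have "(\<Sum>i=1..K. \<phi> (\<Sum>j=1..K. D j i *\<^sub>R x j)) \<le> (\<Sum>i=1..K. \<Sum>j=1..K. D j i * \<phi> (x j))"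
    using assms
    by (intro sum_mono convex_on_sum[where C = UNIV]) (auto simp: doubly_stochastic_def)
  also have "\<dots> = (\<Sum>j=1..K. (\<Sum>i=1..K. D j i) * \<phi> (x j))"
    by (subst sum.swap) (simp add: sum_distrib_right)
  also have "\<dots> = (\<Sum>j=1..K. \<phi> (x j))"
    using assms by (intro sum.cong) (auto simp: doubly_stochastic_def)
  finally show ?thesis .
qed

section \<open>One step of the algorithm: the surrogate and its minimizer\<close>

lemma msa_Q_const:
  assumes "i \<in> {1..K}"
  shows "msa_Q K f \<mu> i (\<lambda>_. w) u =
    f i u + (\<Sum>j\<in>{1..K} - {i}. f j w + gradient (f j) w \<bullet> (u - w))
      + (real K - 1) / (2 * \<mu>) * (norm (u - w))\<^sup>2"
proof -
  \<comment> \<open>All prox centres equal \<open>w\<close>, so the other indices contribute that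
    many copies of one quadratic.\<close>
  have "card ({1..K} - {i}) = K - 1" "1 \<le> K"
    using assms by auto
  then show ?thesis
    by (simp add: msa_Q_def prox_linear_def sum.distrib of_nat_diff)
qed

lemma objective_remove:
  assumes "i \<in> {1..K}"
  shows "objective K f u = f i u + (\<Sum>j\<in>{1..K} - {i}. f j u)"
  unfolding objective_def using assms by (intro sum.remove) auto

text \<open>\<open>arg_min\<close> is a choice operator, so a minimizer must first be shown to
  exist; quadratic growth provides it.\<close>

lemma msa_p_minimizes:
  fixes f :: "nat \<Rightarrow> 'a::euclidean_space \<Rightarrow> real"
  assumes "2 \<le> K" "0 < \<mu>" and i: "i \<in> {1..K}"
    and "convex_on UNIV (f i)" and diff: "\<And>x. f i differentiable (at x)"
  shows "msa_Q K f \<mu> i (\<lambda>_. w) (msa_p K f \<mu> i (\<lambda>_. w)) \<le> msa_Q K f \<mu> i (\<lambda>_. w) u"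
proof -
  let ?Q = "msa_Q K f \<mu> i (\<lambda>_. w)"
  let ?a = "(real K - 1) / (2 * \<mu>)"
  have "continuous_on UNIV (f i)"
    using diff by (simp add: differentiable_imp_continuous_within continuous_on_eq_continuous_within)
  then have cont: "continuous_on UNIV ?Q"
    unfolding msa_Q_const[OF i, abs_def] by (intro continuous_intros)
  have "0 < ?a"
    using assms by simp
  \<comment> \<open>The slope is the sum of all gradients at \<open>w\<close>: \<open>f i\<close>
    lies above its tangent plane, and the other functions enter \<open>?Q\<close> already
    linearized.\<close>
  have "?Q w + (\<Sum>j=1..K. gradient (f j) w) \<bullet> (u - w) + ?a * (norm (u - w))\<^sup>2 \<le> ?Q u" for u
  proof -
    have "(\<Sum>j=1..K. gradient (f j) w) \<bullet> (u - w) =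
        gradient (f i) w \<bullet> (u - w) + (\<Sum>j\<in>{1..K} - {i}. gradient (f j) w \<bullet> (u - w))"
      unfolding inner_sum_left using i by (intro sum.remove) auto
    then show ?thesis
      using convex_on_gradient_ineq[OF assms(4) diff, of w u]
      by (simp add: msa_Q_const[OF i] sum.distrib)
  qed
  then obtain p where "\<And>u. ?Q p \<le> ?Q u"
    using quadratic_growth_attains_min[OF cont \<open>0 < ?a\<close>] by blast
  then show ?thesis
    unfolding msa_p_def using arg_min_equality[of "\<lambda>_. True" p ?Q] by simp
qed

lemma msa_p_decrease:
  fixes f :: "nat \<Rightarrow> 'a::euclidean_space \<Rightarrow> real"
  assumes "2 \<le> K" "0 < \<mu>" and i: "i \<in> {1..K}"
    and conv: "\<And>i. i \<in> {1..K} \<Longrightarrow> convex_on UNIV (f i)"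
    and diff: "\<And>i x. i \<in> {1..K} \<Longrightarrow> f i differentiable (at x)"
    and lip: "\<And>i. i \<in> {1..K} \<Longrightarrow> (1 / \<mu>)-lipschitz_on UNIV (gradient (f i))"
  defines "p \<equiv> \<lambda>w. msa_p K f \<mu> i (\<lambda>_. w)"
  shows "objective K f (p w) - objective K f u
    \<le> (real K - 1) / (2 * \<mu>) * ((norm (u - w))\<^sup>2 - (norm (u - p w))\<^sup>2)"
proof -
  let ?J = "{1..K} - {i}"
  let ?a = "(real K - 1) / (2 * \<mu>)"
  \<comment> \<open>\<open>h\<close> is the surrogate without its quadratic: convex, and below the
    objective.\<close>
  define h where "h u = f i u + (\<Sum>j\<in>?J. f j w + gradient (f j) w \<bullet> (u - w))" for u
  have Q: "msa_Q K f \<mu> i (\<lambda>_. w) u = h u + ?a * (norm (u - w))\<^sup>2" for u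
    unfolding h_def by (rule msa_Q_const[OF i])
  have "convex_on UNIV h"
    unfolding h_def
    by (intro convex_on_add convex_on_sum_functions convex_on_affine_inner conv i)
  moreover have "h (p w) + ?a * (norm (p w - w))\<^sup>2 \<le> h u + ?a * (norm (u - w))\<^sup>2" for u
    unfolding p_def Q[symmetric] using assms by (intro msa_p_minimizes) auto
  ultimately have "h (p w) + ?a * (norm (p w - w))\<^sup>2 + ?a * (norm (u - p w))\<^sup>2
      \<le> h u + ?a * (norm (u - w))\<^sup>2"
    by (rule strongly_convex_minimizer)
  moreover have "objective K f (p w) \<le> h (p w) + ?a * (norm (p w - w))\<^sup>2"
  proof -
    \<comment> \<open>The weight \<open>1 / (2 * \<mu>)\<close> in \<open>prox_linear\<close> is
      that of the descent lemma with constant \<open>1 / \<mu>\<close>, so each model lies above its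
      \<open>f j\<close>.\<close>
    have "objective K f (p w) \<le> msa_Q K f \<mu> i (\<lambda>_. w) (p w)"
      unfolding objective_remove[OF i] msa_Q_def prox_linear_def
      using descent_lemma[OF diff lip]
      by (intro add_left_mono sum_mono) (simp add: field_simps)
    then show ?thesis
      by (simp add: Q)
  qed
  moreover have "h u \<le> objective K f u"
    unfolding objective_remove[OF i] h_def
    using convex_on_gradient_ineq[OF conv diff]
    by (intro add_left_mono sum_mono) auto
  ultimately show ?thesis
    by (simp add: right_diff_distrib)
qed

section \<open>The rate of order 1/k\<close>

lemma card_mult_Min_image_le_sum:
  fixes g :: "'a \<Rightarrow> real"
  assumes "finite A"
  shows "real (card A) * Min (g ` A) \<le> sum g A"
  using assms by (intro sum_bounded_below) auto

text \<open>The comparison point \<open>z\<close> is arbitrary. The potential is \<open>V\<close>,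
  the total squared distance of the mixed points from \<open>z\<close>; its decrease pays for the
  summed gap \<open>S\<close>.\<close>

lemma msa_best_rate:
  fixes f :: "nat \<Rightarrow> 'a::euclidean_space \<Rightarrow> real"
  assumes "2 \<le> K" "0 < \<mu>"
    and conv: "\<And>i. i \<in> {1..K} \<Longrightarrow> convex_on UNIV (f i)"
    and diff: "\<And>i x. i \<in> {1..K} \<Longrightarrow> f i differentiable (at x)"
    and lip: "\<And>i. i \<in> {1..K} \<Longrightarrow> (1 / \<mu>)-lipschitz_on UNIV (gradient (f i))"
    and ds: "\<And>k. 1 \<le> k \<Longrightarrow> doubly_stochastic K (D k)"
    and "1 \<le> k"
  shows "msa_best K f \<mu> D x0 k - objective K f z
    \<le> (real K - 1) * (norm (x0 - z))\<^sup>2 / (2 * \<mu> * real k)"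
proof -
  let ?F = "objective K f"
  let ?x = "msa_x K f \<mu> D x0"
  let ?w = "msa_w K f \<mu> D x0"
  define a where "a = (real K - 1) / (2 * \<mu>)"
  define S where "S k = (\<Sum>i=1..K. ?F (?x k i) - ?F z)" for k
  define V where "V k = (\<Sum>i=1..K. (norm (?w k i - z))\<^sup>2)" for k
  have "0 \<le> a"
    using assms by (simp add: a_def)
  have convF: "convex_on UNIV ?F"
    unfolding objective_def[abs_def] using conv by (rule convex_on_sum_functions)
  have mix: "(\<Sum>i=1..K. \<phi> (?w k i)) \<le> (\<Sum>i=1..K. \<phi> (?x k i))" if "convex_on UNIV \<phi>" for \<phi> k
  \<comment> \<open>At \<open>k = 0\<close> both families consist of copies of \<open>x0\<close>, so
    equality holds.\<close>
  proof (cases k)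
    case (Suc m)
    then show ?thesis
      using doubly_stochastic_convex_sum_le[OF ds that] \<open>2 \<le> K\<close> by simp
  qed simp
  have step: "?F (?x (Suc k) i) - ?F u
      \<le> a * ((norm (u - ?w k i))\<^sup>2 - (norm (u - ?x (Suc k) i))\<^sup>2)" if "i \<in> {1..K}" for k i u
    unfolding a_def msa_x.simps using assms that by (intro msa_p_decrease) auto
  have S_decr: "S (Suc k) \<le> S k" for k
  proof -
    have "(\<Sum>i=1..K. ?F (?x (Suc k) i)) \<le> (\<Sum>i=1..K. ?F (?w k i))"
    proof (rule sum_mono)
      fix i assume "i \<in> {1..K}"
      \<comment> \<open>With \<open>u\<close> equal to the current mixed point the first square
        vanishes, so the bound is nonpositive.\<close>
      then have "?F (?x (Suc k) i) - ?F (?w k i)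
          \<le> a * ((norm (?w k i - ?w k i))\<^sup>2 - (norm (?w k i - ?x (Suc k) i))\<^sup>2)"
        by (rule step)
      moreover have "0 \<le> a * (norm (?w k i - ?x (Suc k) i))\<^sup>2"
        using \<open>0 \<le> a\<close> by simp
      ultimately show "?F (?x (Suc k) i) \<le> ?F (?w k i)"
        by simp
    qed
    also have "\<dots> \<le> (\<Sum>i=1..K. ?F (?x k i))"
      by (rule mix[OF convF])
    finally show ?thesis
      by (simp add: S_def sum_subtractf)
  qed
  have V_decr: "S (Suc k) \<le> a * (V k - V (Suc k))" for k
  proof -
    have "S (Suc k) \<le> (\<Sum>i=1..K. a * ((norm (z - ?w k i))\<^sup>2 - (norm (z - ?x (Suc k) i))\<^sup>2))"
      unfolding S_def by (intro sum_mono step)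
    also have "\<dots> = a * (V k - (\<Sum>i=1..K. (norm (?x (Suc k) i - z))\<^sup>2))"
      by (simp add: V_def sum_distrib_left sum_subtractf norm_minus_commute right_diff_distrib)
    also have "\<dots> \<le> a * (V k - V (Suc k))"
      unfolding V_def using \<open>0 \<le> a\<close>
      by (intro mult_left_mono diff_left_mono mix convex_on_norm_diff_squared)
    finally show ?thesis .
  qed
  \<comment> \<open>In the induction step, \<open>k\<close> of the \<open>k + 1\<close> copies of
    \<open>S (Suc k)\<close> are replaced by \<open>S k\<close> through monotonicity, and the
    remaining copy is paid for by the drop of \<open>V\<close>.\<close>
  have "real k * S k \<le> a * (V 0 - V k)"
  proof (induction k)
    case (Suc k)
    have "real k * S (Suc k) \<le> real k * S k"
      using S_decr by (intro mult_left_mono) auto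
    with Suc V_decr[of k] show ?case
      by (simp add: algebra_simps)
  qed simp
  also have "\<dots> \<le> a * V 0"
    using \<open>0 \<le> a\<close> by (intro mult_left_mono) (simp_all add: V_def sum_nonneg)
  also have "\<dots> = real K * (a * (norm (x0 - z))\<^sup>2)"
    by (simp add: V_def)
  finally have S_le: "real k * S k \<le> real K * (a * (norm (x0 - z))\<^sup>2)" .
  \<comment> \<open>This factor \<open>K\<close> cancels the one in \<open>V 0\<close>, where all
    \<open>K\<close> points equal \<open>x0\<close>.\<close>
  have "real K * (msa_best K f \<mu> D x0 k - ?F z) \<le> S k"
    using card_mult_Min_image_le_sum[of "{1..K}" "\<lambda>i. ?F (?x k i)"]
    by (simp add: msa_best_def S_def sum_subtractf right_diff_distrib)
  then have "real k * (real K * (msa_best K f \<mu> D x0 k - ?F z)) \<le> real k * S k"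
    by (intro mult_left_mono) auto
  with S_le have "real K * (real k * (msa_best K f \<mu> D x0 k - ?F z))
      \<le> real K * (a * (norm (x0 - z))\<^sup>2)"
    by (simp add: mult.left_commute)
  then have "real k * (msa_best K f \<mu> D x0 k - ?F z) \<le> a * (norm (x0 - z))\<^sup>2"
    using \<open>2 \<le> K\<close> by simp
  then show ?thesis
    using \<open>1 \<le> k\<close> \<open>0 < \<mu>\<close> by (simp add: a_def field_simps)
qed

section \<open>Convergence to the optimal value and the iteration count\<close>

lemma msa_best_ge:
  assumes "1 \<le> K" and "\<And>x. objective K f z \<le> objective K f x"
  shows "objective K f z \<le> msa_best K f \<mu> D x0 k"
  unfolding msa_best_def using assms by (intro Min.boundedI) auto

theorem theorem2p6:
  fixes K :: nat
    and f :: "nat \<Rightarrow> real ^ 'n \<Rightarrow> real"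
    and L :: "nat \<Rightarrow> real"
    and Lmax \<mu> :: real
    and D :: "nat \<Rightarrow> nat \<Rightarrow> nat \<Rightarrow> real"
    and x0 xopt :: "real ^ 'n"
  assumes "K \<ge> 2"
    and "\<And>i. i \<in> {1..K} \<Longrightarrow> convex_on UNIV (f i)"
    and "\<And>i. i \<in> {1..K} \<Longrightarrow> continuously_differentiable (f i)"
    and "\<And>i. i \<in> {1..K} \<Longrightarrow> (L i)-lipschitz_on UNIV (gradient (f i))"
    and "Lmax = Max (L ` {1..K})"
    and "Lmax > 0"
    and "\<And>k. k \<ge> 1 \<Longrightarrow> doubly_stochastic K (D k)"
    and "is_arg_min (objective K f) (\<lambda>x. True) xopt"
    and "0 < \<mu>" and "\<mu> \<le> 1 / Lmax"
  shows "(\<forall>k\<ge>1. msa_best K f \<mu> D x0 k - objective K f xopt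
              \<le> (real K - 1) * (norm (x0 - xopt))\<^sup>2 / (2 * \<mu> * real k)) \<and>
         msa_best K f \<mu> D x0 \<longlonglongrightarrow> objective K f xopt \<and>
         (\<forall>\<beta> \<epsilon>. 0 < \<beta> \<and> \<beta> \<le> 1 \<and> \<mu> \<ge> \<beta> / Lmax \<and> \<epsilon> > 0 \<longrightarrow>
            (\<exists>k. msa_best K f \<mu> D x0 k - objective K f xopt \<le> \<epsilon>) \<and>
            int (LEAST k. msa_best K f \<mu> D x0 k - objective K f xopt \<le> \<epsilon>)
              \<le> \<lceil>((real K - 1) * Lmax * (norm (x0 - xopt))\<^sup>2 / (2 * \<beta>)) / \<epsilon>\<rceil>)"
proof (intro conjI allI impI)
  let ?F = "objective K f"
  let ?R = "(real K - 1) * (norm (x0 - xopt))\<^sup>2"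
  \<comment> \<open>The step-size condition says that \<open>1 / \<mu>\<close> dominates every
    \<open>L i\<close>, so it serves as a common Lipschitz constant.\<close>
  have lip: "(1 / \<mu>)-lipschitz_on UNIV (gradient (f i))" if "i \<in> {1..K}" for i
  proof -
    have "L i \<le> Lmax"
      using that unfolding assms(5) by (intro Max_ge) auto
    also have "Lmax \<le> 1 / \<mu>"
      using assms(6,9,10) by (simp add: field_simps)
    finally show ?thesis
      using lipschitz_on_mono[OF assms(4)[OF that]] by blast
  qed
  show rate: "msa_best K f \<mu> D x0 k - ?F xopt \<le> ?R / (2 * \<mu> * real k)" if "1 \<le> k" for k
    using assms(1-3,7,9) that lip
    by (intro msa_best_rate) (auto simp: continuously_differentiable_def)
  have opt: "?F xopt \<le> msa_best K f \<mu> D x0 k" for k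
    using assms(1,8) by (intro msa_best_ge) (auto simp: is_arg_min_linorder)
  have "(\<lambda>k. ?F xopt + ?R / (2 * \<mu>) * inverse (real k)) \<longlonglongrightarrow> ?F xopt + ?R / (2 * \<mu>) * 0"
    by (intro tendsto_intros lim_inverse_n)
  then have upper: "(\<lambda>k. ?F xopt + ?R / (2 * \<mu>) * inverse (real k)) \<longlonglongrightarrow> ?F xopt"
    by simp
  \<comment> \<open>The rate is available only from \<open>k = 1\<close> on, hence an eventual bound
    for the sandwich.\<close>
  have "\<forall>\<^sub>F k in sequentially.
      msa_best K f \<mu> D x0 k \<le> ?F xopt + ?R / (2 * \<mu>) * inverse (real k)"
    using eventually_ge_at_top[of 1]
  proof eventually_elim
    case (elim k)
    have "?R / (2 * \<mu> * real k) = ?R / (2 * \<mu>) * inverse (real k)"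
      by (simp add: field_simps)
    with rate[OF elim] show ?case
      by linarith
  qed
  then show "msa_best K f \<mu> D x0 \<longlonglongrightarrow> ?F xopt"
    by (rule tendsto_sandwich[OF always_eventually[OF allI[OF opt]] _ tendsto_const upper])
  fix \<beta> \<epsilon> :: real
  assume "0 < \<beta> \<and> \<beta> \<le> 1 \<and> \<beta> / Lmax \<le> \<mu> \<and> 0 < \<epsilon>"
  then have "0 < \<beta>" "\<beta> \<le> \<mu> * Lmax" "0 < \<epsilon>"
    using \<open>Lmax > 0\<close> by (simp_all add: pos_divide_le_eq)
  define C where "C = (real K - 1) * Lmax * (norm (x0 - xopt))\<^sup>2 / (2 * \<beta>)"
  have "0 \<le> C"
    using assms(1,6) \<open>0 < \<beta>\<close> by (simp add: C_def)
  have bound: "msa_best K f \<mu> D x0 (nat \<lceil>C / \<epsilon>\<rceil>) - ?F xopt \<le> \<epsilon>"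
  proof (cases "x0 = xopt")
    \<comment> \<open>Here \<open>C\<close> is 0 and the ceiling gives \<open>k = 0\<close>, outside
      the range of the rate; but the starting point is itself optimal.\<close>
    case True
    then show ?thesis
      using \<open>0 < \<epsilon>\<close> \<open>2 \<le> K\<close> by (simp add: C_def msa_best_def image_constant_conv)
  next
    case False
    then have "0 < C"
      using assms(1,6) \<open>0 < \<beta>\<close> by (simp add: C_def)
    define k where "k = nat \<lceil>C / \<epsilon>\<rceil>"
    have "C / \<epsilon> \<le> real k" "0 < C / \<epsilon>"
      using \<open>0 < C\<close> \<open>0 < \<epsilon>\<close> by (simp_all add: k_def real_nat_ceiling_ge)
    then have "0 < real k" and k: "C \<le> \<epsilon> * real k"
      using \<open>0 < \<epsilon>\<close> by (linarith, simp add: field_simps)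
    then have "1 \<le> k"
      by simp
    \<comment> \<open>Dividing by \<open>2 * \<mu> * \<beta>\<close> turns the constant of the rate
      into the \<open>\<mu>\<close>-free constant \<open>C\<close>.\<close>
    have "?R * \<beta> \<le> ?R * (\<mu> * Lmax)"
      using \<open>\<beta> \<le> \<mu> * Lmax\<close> \<open>2 \<le> K\<close> by (intro mult_left_mono) auto
    then have "?R / (2 * \<mu>) \<le> C"
      using \<open>0 < \<beta>\<close> \<open>0 < \<mu>\<close> by (simp add: C_def field_simps)
    then have "?R / (2 * \<mu>) \<le> \<epsilon> * real k"
      using k by linarith
    then have "?R / (2 * \<mu> * real k) \<le> \<epsilon>"
      using \<open>0 < real k\<close> \<open>0 < \<mu>\<close> by (simp add: field_simps)
    with rate[OF \<open>1 \<le> k\<close>] show ?thesis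
      by (simp add: k_def)
  qed
  then show "\<exists>k. msa_best K f \<mu> D x0 k - ?F xopt \<le> \<epsilon>"
    by blast
  from bound have "(LEAST k. msa_best K f \<mu> D x0 k - ?F xopt \<le> \<epsilon>) \<le> nat \<lceil>C / \<epsilon>\<rceil>"
    by (rule Least_le)
  \<comment> \<open>Nonnegativity of the ceiling makes the passage through \<open>nat\<close> and
    back to \<open>int\<close> lossless.\<close>
  moreover have "0 \<le> C / \<epsilon>"
    using \<open>0 \<le> C\<close> \<open>0 < \<epsilon>\<close> by simp
  then have "0 \<le> \<lceil>C / \<epsilon>\<rceil>"
    by linarith
  ultimately show "int (LEAST k. msa_best K f \<mu> D x0 k - ?F xopt \<le> \<epsilon>)
      \<le> \<lceil>((real K - 1) * Lmax * (norm (x0 - xopt))\<^sup>2 / (2 * \<beta>)) / \<epsilon>\<rceil>"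
    unfolding C_def by linarith
qed

end
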